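(* Let $d,k\ge 1$ and $n\ge0$ be integers, and let $\overline{M[d]}^+_k(n)$ denote the $k$th positive moment of the $d$th residual crank of overpartitions of $n$ (defined in the context). Then $$\overline{M[d]}^+_k(n)\le \overline{M[d]}^+_{k+1}(n),$$ with equality if and only if $n<2d$.
   Context: An overpartition of $n$ is a non-increasing sequence of positive integers summing to $n$ in which the first occurrence of each distinct part value may be overlined. For an ordinary partition $\mu$, let $\omega(\mu)$ be the number of parts equal to $1$; the crank $cr(\mu)$ is the largest part of $\mu$ if $\omega(\mu)=0$ (with $cr(\emptyset)=0$), and otherwise is the number of parts of $\mu$ exceeding $\omega(\mu)$ minus $\omega(\mu)$. Following the Andrews–Garvan convention, define weights $c_m(\mu)$ for $m\in\mathbb Z$: if $\mu\ne(1)$ then $c_m(\mu)=1$ if $cr(\mu)=m$ and $0$ otherwise; for $\mu=(1)$ set $c_1=c_{-1}=1$, $c_0=-1$, and $c_m=0$ for other $m$. For an overpartition $\lambda$ and integer $d\ge1$, let $\lambda'$ be the partition formed by the non-overlined parts of $\lambda$ that are divisible by $d$, each divided by $d$; the $d$th residual crank of $\lambda$ is $cr(\lambda')$. Set $\overline{M[d]}(m,n)=\sum_{\lambda} c_m(\lambda')$, the sum over all overpartitions $\lambda$ of $n$, and define the $k$th positive moment $\overline{M[d]}^+_k(n)=\sum_{m\ge1} m^k\,\overline{M[d]}(m,n)$. *)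

theory Defs
  imports "HOL-Analysis.Analysis"
begin

text \<open>
  A part of an overpartition is a pair of its size and a flag telling whether it is overlined.
  Only the first occurrence of a size may carry the flag.
\<close>

definition overpartitions :: "nat \<Rightarrow> (nat \<times> bool) list set" where
  "overpartitions n =
     {ps. sorted_wrt (\<ge>) (map fst ps) \<and>
         (\<forall>p\<in>set ps. fst p > 0) \<and>
         sum_list (map fst ps) = n \<and>
         (\<forall>i<length ps. snd (ps ! i) \<longrightarrow> (\<forall>j<i. fst (ps ! j) \<noteq> fst (ps ! i)))}"

text \<open>An ordinary partition is the list of its parts in non-increasing order.\<close>

definition ones :: "nat list \<Rightarrow> nat" where
  "ones \<mu> = count_list \<mu> 1"

definition crank :: "nat list \<Rightarrow> int" where
  "crank \<mu> =
     (if \<mu> = [] then 0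
      else if ones \<mu> = 0 then int (Max (set \<mu>))
      else int (length (filter (\<lambda>p. p > ones \<mu>) \<mu>)) - int (ones \<mu>))"

text \<open>The Andrews--Garvan weights, which differ from counting by crank only at the partition (1).\<close>

definition crank_weight :: "int \<Rightarrow> nat list \<Rightarrow> int" where
  "crank_weight m \<mu> =
     (if \<mu> = [1] then (if m = 1 \<or> m = - 1 then 1 else if m = 0 then - 1 else 0)
      else if crank \<mu> = m then 1 else 0)"

definition residual_partition :: "nat \<Rightarrow> (nat \<times> bool) list \<Rightarrow> nat list" where
  "residual_partition d ps =
     map (\<lambda>p. fst p div d) (filter (\<lambda>p. \<not> snd p \<and> d dvd fst p) ps)"

definition residual_crank :: "nat \<Rightarrow> (nat \<times> bool) list \<Rightarrow> int" where
  "residual_crank d ps = crank (residual_partition d ps)"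

lemma crank_weight_residual_partition:
  "residual_partition d ps \<noteq> [1] \<Longrightarrow>
     crank_weight m (residual_partition d ps) = (if residual_crank d ps = m then 1 else 0)"
  by (simp add: crank_weight_def residual_crank_def)

definition residual_crank_count :: "nat \<Rightarrow> int \<Rightarrow> nat \<Rightarrow> int" where
  "residual_crank_count d m n =
     (\<Sum>ps\<in>overpartitions n. crank_weight m (residual_partition d ps))"

definition positive_moment :: "nat \<Rightarrow> nat \<Rightarrow> nat \<Rightarrow> int" where
  "positive_moment d k n = (\<Sum>\<^sub>\<infinity>m\<in>{1..}. m ^ k * residual_crank_count d m n)"

text \<open>Both sums above have only finitely many nonzero terms, so neither one takes a default value.\<close>

lemma length_le_sum_list: "(\<forall>x\<in>set xs. 0 < (x::nat)) \<Longrightarrow> length xs \<le> sum_list xs"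
  by (induction xs) fastforce+

lemma finite_overpartitions: "finite (overpartitions n)"
proof (rule finite_subset)
  show "overpartitions n \<subseteq> {ps. set ps \<subseteq> {..n} \<times> UNIV \<and> length ps \<le> n}"
  proof
    fix ps :: "(nat \<times> bool) list"
    assume "ps \<in> overpartitions n"
    then have pos: "\<forall>x\<in>set (map fst ps). 0 < x" and sum: "sum_list (map fst ps) = n"
      by (auto simp: overpartitions_def)
    have "length ps \<le> n"
      using length_le_sum_list[OF pos] sum by simp
    moreover have "fst p \<le> n" if "p \<in> set ps" for p
      using member_le_sum_list[of "fst p" "map fst ps"] that sum by simp
    ultimately show "ps \<in> {ps. set ps \<subseteq> {..n} \<times> UNIV \<and> length ps \<le> n}"
      by force
  qed
  show "finite {ps. set ps \<subseteq> {..n} \<times> (UNIV :: bool set) \<and> length ps \<le> n}"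
    by (rule finite_lists_length_le) simp
qed

lemma crank_le:
  assumes "\<forall>x\<in>set \<mu>. 0 < x"
  shows "crank \<mu> \<le> int (sum_list \<mu>)"
proof (cases "\<mu> = [] \<or> ones \<mu> \<noteq> 0")
  case True
  have "length (filter P \<mu>) \<le> sum_list \<mu>" for P
    using length_filter_le length_le_sum_list[OF assms] by (rule le_trans)
  then have "int (length (filter P \<mu>)) - int (ones \<mu>) \<le> int (sum_list \<mu>)" for P
    by (smt (verit) of_nat_0_le_iff of_nat_mono)
  with True show ?thesis
    by (auto simp: crank_def)
next
  case False
  then have "Max (set \<mu>) \<in> set \<mu>"
    by simp
  then have "Max (set \<mu>) \<le> sum_list \<mu>"
    by (rule member_le_sum_list) simp
  with False show ?thesis
    by (simp add: crank_def)
qed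

lemma residual_partition_pos:
  assumes "ps \<in> overpartitions n" "x \<in> set (residual_partition d ps)"
  shows "0 < x"
  using assms
  by (auto simp: overpartitions_def residual_partition_def elim!: dvdE)

lemma sum_list_residual_partition_le:
  assumes "ps \<in> overpartitions n"
  shows "sum_list (residual_partition d ps) \<le> n"
proof -
  have "sum_list (residual_partition d ps) \<le> sum_list (map fst ps)"
    unfolding residual_partition_def
  proof (induction ps)
    case (Cons p ps)
    then show ?case
      using div_le_dividend[of "fst p" d] by (auto simp del: div_le_dividend)
  qed simp
  then show ?thesis
    using assms by (simp add: overpartitions_def)
qed

lemma residual_crank_count_eq_0:
  assumes "m > int n" "m > 1"
  shows "residual_crank_count d m n = 0"
  unfolding residual_crank_count_def
proof (rule sum.neutral, rule ballI)
  fix ps assume ps: "ps \<in> overpartitions n"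
  have "crank (residual_partition d ps) \<le> int n"
    using crank_le[of "residual_partition d ps"] residual_partition_pos[OF ps]
      sum_list_residual_partition_le[OF ps, of d] by force
  with assms show "crank_weight m (residual_partition d ps) = 0"
    by (simp add: crank_weight_def)
qed

lemma positive_moment_eq_sum:
  "positive_moment d k n = (\<Sum>m\<in>{1..max 1 (int n)}. m ^ k * residual_crank_count d m n)"
proof -
  have "positive_moment d k n =
          (\<Sum>\<^sub>\<infinity>m\<in>{1..max 1 (int n)}. m ^ k * residual_crank_count d m n)"
    unfolding positive_moment_def
    by (rule infsum_cong_neutral) (auto simp: residual_crank_count_eq_0)
  then show ?thesis
    by simp
qed

end

theory Submission
  imports Defs
begin

text \<open>
  The difference of consecutive moments is the sum of (m - 1) m^k times the count at m. The
  term m = 1 vanishes, and for m \<ge> 2 the weights are 0 or 1, because the exceptional partition (1)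
  has weight 0 there. So all terms are nonnegative, and equality means that no residual crank is at least 2.
  This holds if n < 2d, when the residual partition is empty or (1). If n \<ge> 2d, a non-overlined
  part 2d together with an overlined part n - 2d (if nonzero) has residual partition (2), of crank 2.
\<close>

lemma residual_crank_count_nonneg:
  assumes "m \<ge> 2"
  shows "residual_crank_count d m n \<ge> 0"
  unfolding residual_crank_count_def
  using assms by (intro sum_nonneg) (auto simp: crank_weight_def)

text \<open>The summation range does not depend on the exponent, so the two moments subtract term by
  term.\<close>

lemma positive_moment_diff:
  "positive_moment d (k + 1) n - positive_moment d k n =
     (\<Sum>m\<in>{1..max 1 (int n)}. (m - 1) * m ^ k * residual_crank_count d m n)"
  unfolding positive_moment_eq_sum sum_subtractf[symmetric]
  by (intro sum.cong) (auto simp: algebra_simps)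

text \<open>Multiplying by \<open>d\<close> turns each residual part back into the part of
  \<open>ps\<close> it came from, and discarded parts only lower the sum.\<close>

lemma mult_sum_list_residual_partition_le:
  assumes "ps \<in> overpartitions n"
  shows "d * sum_list (residual_partition d ps) \<le> n"
proof -
  have "d * sum_list (residual_partition d ps) \<le> sum_list (map fst ps)"
    unfolding residual_partition_def by (induction ps) (auto simp: algebra_simps)
  then show ?thesis
    using assms by (simp add: overpartitions_def)
qed

lemma pos_list_sum_less_2:
  fixes xs :: "nat list"
  assumes "\<forall>x\<in>set xs. 0 < x" "sum_list xs < 2"
  shows "xs = [] \<or> xs = [1]"
proof (cases xs)
  case (Cons y ys)
  with assms have "0 < y" "y + sum_list ys < 2"
    by auto
  then have "sum_list ys = 0" "y = 1"
    by linarith+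
  moreover have "length ys \<le> sum_list ys"
    using assms Cons by (intro length_le_sum_list) auto
  ultimately have "length ys \<le> 0" "y = 1"
    by linarith+
  with Cons show ?thesis
    by simp
qed simp

lemma residual_crank_count_eq_0_if_small:
  assumes "n < 2 * d" "m \<ge> 2"
  shows "residual_crank_count d m n = 0"
  unfolding residual_crank_count_def
proof (rule sum.neutral, rule ballI)
  fix ps assume ps: "ps \<in> overpartitions n"
  have "d * sum_list (residual_partition d ps) < d * 2"
    using mult_sum_list_residual_partition_le[OF ps, of d] assms(1) by linarith
  then have "sum_list (residual_partition d ps) < 2"
    by (simp only: mult_less_cancel1)
  then have "residual_partition d ps = [] \<or> residual_partition d ps = [1]"
    using residual_partition_pos[OF ps] by (intro pos_list_sum_less_2) auto
  \<comment> \<open>\<open>[]\<close> has crank 0, and the weights of \<open>[1]\<close> are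
    supported on -1, 0, 1.\<close>
  with assms show "crank_weight m (residual_partition d ps) = 0"
    by (auto simp: crank_weight_def crank_def)
qed

lemma ex_residual_partition_eq_2:
  assumes "d \<ge> 1" "2 * d \<le> n"
  shows "\<exists>ps\<in>overpartitions n. residual_partition d ps = [2]"
proof -
  define r where "r = n - 2 * d"
  \<comment> \<open>The overline hides \<open>r\<close> from the residual partition even when
    \<open>d\<close> divides it. The cases keep the parts non-increasing; if
    \<open>r = 2 * d\<close>, the overlined copy must come first.\<close>
  define ps where "ps = (if r = 0 then [(2 * d, False)]
    else if r < 2 * d then [(2 * d, False), (r, True)] else [(r, True), (2 * d, False)])"
  have "ps \<in> overpartitions n"
    using assms by (auto simp: overpartitions_def ps_def r_def less_Suc_eq)
  moreover have "residual_partition d ps = [2]"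
    using assms by (auto simp: residual_partition_def ps_def)
  ultimately show ?thesis
    by blast
qed

lemma residual_crank_count_2_pos:
  assumes "d \<ge> 1" "2 * d \<le> n"
  shows "residual_crank_count d 2 n > 0"
proof -
  obtain ps where ps: "ps \<in> overpartitions n" "residual_partition d ps = [2]"
    using ex_residual_partition_eq_2[OF assms] by blast
  show ?thesis
    unfolding residual_crank_count_def
    by (rule sum_pos2[OF finite_overpartitions ps(1)])
      (auto simp: ps(2) crank_weight_def crank_def ones_def)
qed

theorem theorem2:
  fixes d k n :: nat
  assumes "d \<ge> 1" and "k \<ge> 1"
  shows "positive_moment d k n \<le> positive_moment d (k + 1) n \<and>
         (positive_moment d k n = positive_moment d (k + 1) n \<longleftrightarrow> n < 2 * d)"
proof -
  let ?t = "\<lambda>m. (m - 1) * m ^ k * residual_crank_count d m n"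
  have nonneg: "?t m \<ge> 0" if "m \<in> {1..max 1 (int n)}" for m
  \<comment> \<open>At \<open>m = 1\<close> the factor \<open>m - 1\<close> vanishes; from 2 on the
    counts are nonnegative.\<close>
  proof (cases "m = 1")
    case False
    with that show ?thesis
      using residual_crank_count_nonneg[of m d n] by simp
  qed simp
  have diff: "positive_moment d (k + 1) n - positive_moment d k n = sum ?t {1..max 1 (int n)}"
    by (rule positive_moment_diff)
  show ?thesis
  proof (cases "n < 2 * d")
    case True
    have "?t m = 0" if "m \<in> {1..max 1 (int n)}" for m
    proof (cases "m = 1")
      case False
      with that show ?thesis
        using residual_crank_count_eq_0_if_small[OF True, of m] by simp
    qed simp
    then have "sum ?t {1..max 1 (int n)} = 0"
      by (intro sum.neutral) blast
    with diff True show ?thesis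
      by simp
  next
    case False
    then have "?t 2 > 0"
      using residual_crank_count_2_pos[of d n] assms by simp
    \<comment> \<open>Here \<open>n\<close> \<ge> \<open>2 * d\<close> \<ge> 2, so the index 2 lies
      in the range.\<close>
    moreover have "2 \<in> {1..max 1 (int n)}"
      using False assms by auto
    ultimately have "sum ?t {1..max 1 (int n)} > 0"
      using nonneg by (intro sum_pos2[of _ 2]) simp_all
    with diff False show ?thesis
      by simp
  qed
qed

end
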